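(* Let $L \subset \mathbb{N}_{\ge 2}$ be a finite nonempty subset. Then there are only finitely many pairwise non-isomorphic finite abelian groups $G$ such that $L \notin \mathcal{L}(G)$.
   Context: $\mathbb{N}$ is the set of positive integers and $\mathbb{N}_{\ge 2} = \{n \in \mathbb{N} \mid n \ge 2\}$. For an additive abelian group $G$, let $\mathcal{F}(G)$ be the free abelian monoid (written multiplicatively) with basis $G$; its elements are called sequences over $G$: $S = g_1 \cdots g_\ell$, i.e. finite multisets of elements of $G$, with sum $\sigma(S) = g_1 + \dots + g_\ell$. $\mathcal{B}(G) = \{S \in \mathcal{F}(G) \mid \sigma(S) = 0\}$ is the monoid of zero-sum sequences over $G$; its identity is the empty sequence. An atom (irreducible element) of $\mathcal{B}(G)$ is a nonempty zero-sum sequence which is not a product of two nonempty zero-sum sequences; note the sequence consisting of the single term $0$ is an atom. For a nonempty $A \in \mathcal{B}(G)$, its set of lengths $\mathsf{L}(A)$ is the set of all $k \in \mathbb{N}$ such that $A$ is a product of $k$ atoms; for the empty sequence, $\mathsf{L} = \{0\}$. $\mathcal{L}(G) = \{ \mathsf{L}(A) \mid A \in \mathcal{B}(G) \}$ is the system of sets of lengths. *)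

theory Defs
  imports "HOL-Algebra.Divisibility" "HOL-Algebra.FiniteProduct" "HOL-Library.Multiset"
begin

text \<open>
  Finite abelian groups are the commutative groups (\<open>comm_group\<close>) of HOL-Algebra, which are
  written multiplicatively: what is a zero-sum sequence over an additively written group is here a
  sequence whose product is \<open>\<one>\<close>. A sequence over \<open>G\<close> is a finite multiset of elements
  of \<open>carrier G\<close>, and the product of sequences is multiset sum.
\<close>

text \<open>
  \<open>\<sigma>(S) = \<Sum>\<^sub>g v\<^sub>g(S) g\<close>, where \<open>v\<^sub>g(S)\<close> is the multiplicity of \<open>g\<close> in \<open>S\<close>.
\<close>

definition seq_sum :: "('a, 'b) monoid_scheme \<Rightarrow> 'a multiset \<Rightarrow> 'a" where
  "seq_sum G S = finprod G (\<lambda>g. g [^]\<^bsub>G\<^esub> count S g) (set_mset S)"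

definition zero_sum_monoid :: "('a, 'b) monoid_scheme \<Rightarrow> 'a multiset monoid" where
  "zero_sum_monoid G =
     \<lparr>carrier = {S. set_mset S \<subseteq> carrier G \<and> seq_sum G S = \<one>\<^bsub>G\<^esub>}, mult = (+), one = {#}\<rparr>"

definition zero_sum_atoms :: "('a, 'b) monoid_scheme \<Rightarrow> 'a multiset set" where
  "zero_sum_atoms G = {A \<in> carrier (zero_sum_monoid G). irreducible (zero_sum_monoid G) A}"

text \<open>
  A product of \<open>k\<close> atoms is given by the multiset \<open>F\<close> of its \<open>k\<close> factors. The empty sequence needs no
  separate clause, see \<open>length_set_empty\<close> and \<open>length_set_pos\<close> below.
\<close>

definition length_set :: "('a, 'b) monoid_scheme \<Rightarrow> 'a multiset \<Rightarrow> nat set" where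
  "length_set G A = {k. \<exists>F. set_mset F \<subseteq> zero_sum_atoms G \<and> size F = k \<and> \<Sum>\<^sub># F = A}"

definition length_sets_system :: "('a, 'b) monoid_scheme \<Rightarrow> nat set set" where
  "length_sets_system G = length_set G ` carrier (zero_sum_monoid G)"

context comm_monoid
begin

lemma empty_in_zero_sum_monoid: "{#} \<in> carrier (zero_sum_monoid G)"
  by (simp add: zero_sum_monoid_def seq_sum_def)

lemma Units_zero_sum_monoid: "Units (zero_sum_monoid G) = {{#}}"
  using empty_in_zero_sum_monoid by (auto simp: Units_def zero_sum_monoid_def)

lemma zero_sum_atoms_iff:
  "A \<in> zero_sum_atoms G \<longleftrightarrow>
     A \<in> carrier (zero_sum_monoid G) \<and> A \<noteq> {#} \<and>
     \<not> (\<exists>B C. B \<in> carrier (zero_sum_monoid G) \<and> C \<in> carrier (zero_sum_monoid G) \<and>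
            B \<noteq> {#} \<and> C \<noteq> {#} \<and> A = B + C)"
proof -
  have mult: "X \<otimes>\<^bsub>zero_sum_monoid G\<^esub> Y = X + Y" for X Y
    by (simp add: zero_sum_monoid_def)
  have "properfactor (zero_sum_monoid G) B A \<longleftrightarrow>
      (\<exists>C \<in> carrier (zero_sum_monoid G). C \<noteq> {#} \<and> A = B + C)" for B
  proof
    assume "properfactor (zero_sum_monoid G) B A"
    then obtain C where C: "C \<in> carrier (zero_sum_monoid G)" "A = B + C"
      and n: "\<not> A divides\<^bsub>zero_sum_monoid G\<^esub> B"
      by (auto simp: properfactor_def factor_def mult)
    have "C \<noteq> {#}"
    proof
      assume "C = {#}"
      then have "B = A + {#}" using C by simp
      then show False using n empty_in_zero_sum_monoid unfolding factor_def mult by blast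
    qed
    then show "\<exists>C \<in> carrier (zero_sum_monoid G). C \<noteq> {#} \<and> A = B + C" using C by blast
  next
    assume "\<exists>C \<in> carrier (zero_sum_monoid G). C \<noteq> {#} \<and> A = B + C"
    then show "properfactor (zero_sum_monoid G) B A"
      by (auto simp: properfactor_def factor_def mult)
  qed
  then show ?thesis
    unfolding zero_sum_atoms_def irreducible_def Units_zero_sum_monoid by auto
qed

lemma length_set_empty: "length_set G {#} = {0}"
proof -
  have "F = {#}" if "set_mset F \<subseteq> zero_sum_atoms G" "\<Sum>\<^sub># F = {#}" for F
  proof (rule ccontr)
    assume "F \<noteq> {#}"
    then obtain A where "A \<in># F" by blast
    with that have "A \<noteq> {#}" "A = {#}" by (auto simp: zero_sum_atoms_iff)
    then show False by simp
  qed
  then show ?thesis by (force simp: length_set_def)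
qed

end

lemma length_set_pos: "A \<noteq> {#} \<Longrightarrow> k \<in> length_set G A \<Longrightarrow> k \<ge> 1"
  by (cases k) (auto simp: length_set_def)

end

theory Submission
  imports Defs "HOL-Library.Disjoint_Sets"
begin

text \<open>
  Adding \<open>s\<close> terms equal to the neutral element shifts a set of lengths by \<open>s\<close>, so we may assume
  \<open>2 \<in> L\<close>. Let \<open>X = \<Prod>\<^bsub>l \<in> L\<^esub> {0..<l}\<close>, and let \<open>f\<close> range over the functions on \<open>X\<close> with values 0
  and 1. Attach group elements to the points of \<open>X\<close> such that a subset of \<open>X\<close> is zero-sum if its
  indicator function \<open>f\<close> is a sum of functions of one coordinate each, and only if this holds modulo
  2. The blocks \<open>{x. x\<^sub>l = c}\<close> are then zero-sum, and for each \<open>l \<in> L\<close> they partition \<open>X\<close> into \<open>l\<close>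
  atoms. If some factor in a factorization of \<open>X\<close> depends on two coordinates, the only set of this
  kind that is disjoint from it is its complement, and the length is 2. Otherwise all factors are
  blocks, and since blocks in different directions intersect, they have the same direction; the
  length is in \<open>L\<close>.

  Such group elements are obtained from elements \<open>E\<^sub>r\<close>, one for each relation \<open>r\<close> that \<open>f\<close> has to
  satisfy, such that a relation between the \<open>E\<^sub>r\<close> with coefficients in \<open>{-2..2}\<close> has even coefficients
  only. They can be chosen greedily in every abelian group of sufficiently large order: inside the
  2-torsion if it is large, and avoiding the few square roots of earlier combinations if it is
  small. Hence the groups in question have bounded order.
\<close>

subsection \<open>Mod 2 additive subsets of a grid\<close>

definition grid :: "nat set \<Rightarrow> (nat \<Rightarrow> nat) set" where
  "grid I = (\<Pi>\<^sub>E i\<in>I. {..<i})"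

definition block :: "nat set \<Rightarrow> nat \<Rightarrow> nat \<Rightarrow> (nat \<Rightarrow> nat) set" where
  "block I i c = {x \<in> grid I. x i = c}"

text \<open>
  For the indicator function \<open>f\<close> of \<open>S\<close> this says that \<open>f x + f y = f (x(i := y i)) + f (y(i := x i))\<close>
  modulo 2, that is, \<open>f\<close> is modulo 2 a sum of functions of one coordinate each.
\<close>

definition exchange :: "nat set \<Rightarrow> (nat \<Rightarrow> nat) set \<Rightarrow> bool" where
  "exchange I S \<longleftrightarrow> (\<forall>i\<in>I. \<forall>x\<in>grid I. \<forall>y\<in>grid I.
     ((x \<in> S) = (y \<in> S)) = ((x(i := y i) \<in> S) = (y(i := x i) \<in> S)))"

text \<open>For a mod 2 additive \<open>S\<close> this says that the summand belonging to coordinate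
  \<open>i\<close> is not constant.\<close>

definition varies :: "nat set \<Rightarrow> nat \<Rightarrow> (nat \<Rightarrow> nat) set \<Rightarrow> bool" where
  "varies I i S \<longleftrightarrow> (\<exists>x\<in>grid I. \<exists>a<i. (x(i := a) \<in> S) \<noteq> (x \<in> S))"

text \<open>The counterpart of an atom when \<open>Z\<close> expresses that the elements attached to
  a set of points have trivial product; see \<open>atom_image_iff\<close>.\<close>

definition minimal_in :: "('b set \<Rightarrow> bool) \<Rightarrow> 'b set \<Rightarrow> bool" where
  "minimal_in Z S \<longleftrightarrow> S \<noteq> {} \<and> Z S \<and> (\<forall>T. T \<subset> S \<longrightarrow> T \<noteq> {} \<longrightarrow> \<not> Z T)"

lemma finite_grid: "finite I \<Longrightarrow> finite (grid I)"
  by (auto simp: grid_def intro: finite_PiE)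

lemma grid_upd: "x \<in> grid I \<Longrightarrow> i \<in> I \<Longrightarrow> a < i \<Longrightarrow> x(i := a) \<in> grid I"
  by (auto simp: grid_def PiE_def Pi_def extensional_def)

lemma grid_less: "x \<in> grid I \<Longrightarrow> i \<in> I \<Longrightarrow> x i < i"
  by (auto simp: grid_def)

lemma exchange_block: "i \<in> I \<Longrightarrow> exchange I (block I i c)"
  by (auto simp: exchange_def block_def grid_upd grid_less)

text \<open>Exchanging coordinate \<open>i\<close> between \<open>u\<close> and
  \<open>y(i := a)\<close> compares the change at \<open>u\<close> with the change at
  \<open>y\<close>, so a change between two values that occurs at one point occurs at every
  point.\<close>

lemma varies_everywhere:
  assumes S: "exchange I S" and "i \<in> I" and "varies I i S"
  obtains p a where "p < i" "a < i"
    "\<And>y. y \<in> grid I \<Longrightarrow> (y(i := p) \<in> S) \<noteq> (y(i := a) \<in> S)"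
proof -
  obtain u a where u: "u \<in> grid I" "a < i" "(u(i := a) \<in> S) \<noteq> (u \<in> S)"
    using assms(3) unfolding varies_def by blast
  have "(y(i := u i) \<in> S) \<noteq> (y(i := a) \<in> S)" if y: "y \<in> grid I" for y
  proof -
    have g: "y(i := a) \<in> grid I" using grid_upd[OF y] assms u by blast
    show ?thesis using S[unfolded exchange_def, rule_format, OF assms(2) u(1) g] u(3) by auto
  qed
  then show thesis using that[of "u i" a] u grid_less assms by blast
qed

text \<open>Exchanging coordinate \<open>i\<close> between opposite corners of a rectangle yields
  the other two corners.\<close>

lemma exchange_corner:
  assumes "exchange I S" "i \<in> I" "j \<in> I" "i \<noteq> j" "p < i" "q < j" "y \<in> grid I"
  shows "((y \<in> S) = (y(i := p, j := q) \<in> S)) = ((y(i := p) \<in> S) = (y(j := q) \<in> S))"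
proof -
  have g: "y(i := p, j := q) \<in> grid I" using assms by (simp add: grid_upd)
  have "(y(i := p, j := q))(i := y i) = y(j := q)" using \<open>i \<noteq> j\<close> by (auto simp: fun_eq_iff)
  then show ?thesis
    using assms(1)[unfolded exchange_def, rule_format, OF assms(2,7) g] \<open>i \<noteq> j\<close> by simp
qed

text \<open>
  On each of the slices \<open>x\<^sub>i \<in> {p, a}\<close> and \<open>x\<^sub>j \<in> {q, b}\<close>, where \<open>S\<close> varies, the disjoint set
  \<open>T\<close> is either empty or the complement of \<open>S\<close>, with the same alternative on all of them. Every
  other point is the fourth corner of a rectangle whose other three corners lie on these slices.
\<close>

lemma disjoint_varies_two:
  assumes S: "exchange I S" and T: "exchange I T" and ij: "i \<in> I" "j \<in> I" "i \<noteq> j"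
    and vi: "varies I i S" and vj: "varies I j S"
    and disj: "S \<inter> T = {}" and ne: "T \<noteq> {}" and sub: "T \<subseteq> grid I" "S \<subseteq> grid I"
  shows "T = grid I - S"
proof -
  obtain p a where pa: "p < i" "a < i"
    "\<And>y. y \<in> grid I \<Longrightarrow> (y(i := p) \<in> S) \<noteq> (y(i := a) \<in> S)"
    using varies_everywhere[OF S ij(1) vi] by metis
  obtain q b where qb: "q < j" "b < j"
    "\<And>y. y \<in> grid I \<Longrightarrow> (y(j := q) \<in> S) \<noteq> (y(j := b) \<in> S)"
    using varies_everywhere[OF S ij(2) vj] by metis
  have d: "\<not> (z \<in> S \<and> z \<in> T)" for z using disj by blast
  \<comment> \<open>By exchange, whether \<open>T\<close> changes between the values
    \<open>p\<close> and \<open>a\<close> does not depend on the base point.\<close>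
  have Ti: "((y(i := p) \<in> T) \<noteq> (y(i := a) \<in> T)) = ((z(i := p) \<in> T) \<noteq> (z(i := a) \<in> T))"
    if y: "y \<in> grid I" and z: "z \<in> grid I" for y z
    using T[unfolded exchange_def, rule_format, OF ij(1), of "y(i := p)" "z(i := a)"]
      grid_upd[OF y ij(1) pa(1)] grid_upd[OF z ij(1) pa(2)] by auto
  have Tj: "((y(j := q) \<in> T) \<noteq> (y(j := b) \<in> T)) = ((z(j := q) \<in> T) \<noteq> (z(j := b) \<in> T))"
    if y: "y \<in> grid I" and z: "z \<in> grid I" for y z
    using T[unfolded exchange_def, rule_format, OF ij(2), of "y(j := q)" "z(j := b)"]
      grid_upd[OF y ij(2) qb(1)] grid_upd[OF z ij(2) qb(2)] by auto
  obtain w where w: "w \<in> grid I" using ne sub by blast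
  have wj: "w(j := q) \<in> grid I" "w(j := b) \<in> grid I" "w(i := p) \<in> grid I" "w(i := a) \<in> grid I"
    using w ij pa qb grid_upd by auto
  have comm: "w(j := c, i := e) = w(i := e, j := c)" for c e
    using ij(3) by (rule fun_upd_twist[symmetric])
  show ?thesis
  proof (cases "(w(i := p) \<in> T) \<noteq> (w(i := a) \<in> T)")
    case True
    have ci: "(y(i := p) \<in> T) = (y(i := p) \<notin> S)" if "y \<in> grid I" for y
      using Ti[OF that w] True pa(3)[OF that] d by blast
    \<comment> \<open>At the four points with coordinates \<open>p\<close> or \<open>a\<close> in
      direction \<open>i\<close> and \<open>q\<close> or \<open>b\<close> in direction
      \<open>j\<close>, \<open>T\<close> is the complement of \<open>S\<close>, so it varies in
      direction \<open>j\<close> too. This carries the alternative from direction \<open>i\<close>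
      to direction \<open>j\<close>.\<close>
    have "(w(j := q, i := p) \<in> T) \<noteq> (w(j := q, i := a) \<in> T)"
      using Ti[OF wj(1) w] True by blast
    moreover have "(w(j := b, i := p) \<in> T) \<noteq> (w(j := b, i := a) \<in> T)"
      using Ti[OF wj(2) w] True by blast
    ultimately have "(w(j := q) \<in> T) \<noteq> (w(j := b) \<in> T)"
      using pa(3)[OF wj(1)] pa(3)[OF wj(2)] qb(3)[OF wj(3)] qb(3)[OF wj(4)] d Tj[OF wj(3) w]
      unfolding comm by blast
    then have cj: "(y(j := q) \<in> T) = (y(j := q) \<notin> S)" if "y \<in> grid I" for y
      using Tj[OF that w] qb(3)[OF that] d by blast
    have "(y \<in> T) = (y \<notin> S)" if y: "y \<in> grid I" for y
      using exchange_corner[OF S ij pa(1) qb(1) y] exchange_corner[OF T ij pa(1) qb(1) y]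
        ci[OF y] cj[OF y] cj[OF grid_upd[OF y ij(1) pa(1)]] by blast
    then show ?thesis using sub by blast
  next
    case False
    have ci: "y(i := p) \<notin> T" if "y \<in> grid I" for y
      using Ti[OF that w] False pa(3)[OF that] d by blast
    have "w(j := q, i := p) \<notin> T" "w(j := q, i := a) \<notin> T" "w(j := b, i := p) \<notin> T"
      "w(j := b, i := a) \<notin> T"
      using Ti[OF wj(1) w] Ti[OF wj(2) w] pa(3)[OF wj(1)] pa(3)[OF wj(2)] False d by blast+
    then have "\<not> ((w(j := q) \<in> T) \<noteq> (w(j := b) \<in> T))"
      using Tj[OF wj(3) w] unfolding comm by blast
    then have cj: "y(j := q) \<notin> T" if "y \<in> grid I" for y
      using Tj[OF that w] qb(3)[OF that] d by blast
    have "y \<notin> T" if y: "y \<in> grid I" for y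
      using exchange_corner[OF T ij pa(1) qb(1) y]
        ci[OF y] cj[OF y] cj[OF grid_upd[OF y ij(1) pa(1)]] by blast
    then show ?thesis using sub ne by blast
  qed
qed

text \<open>The coordinates in \<open>J\<close> are changed one at a time.\<close>

lemma not_varies_agree:
  assumes "finite J" "J \<subseteq> I" "\<And>j. j \<in> J \<Longrightarrow> \<not> varies I j S"
    and "x \<in> grid I" "y \<in> grid I" "\<And>k. k \<notin> J \<Longrightarrow> x k = y k"
  shows "x \<in> S \<longleftrightarrow> y \<in> S"
  using assms
proof (induction J arbitrary: x rule: finite_induct)
  case empty
  then have "x = y" by auto
  then show ?case by simp
next
  case (insert j J)
  have lt: "y j < j" using insert.prems grid_less by blast
  have "x(j := y j) \<in> S \<longleftrightarrow> y \<in> S"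
    using insert.prems insert.hyps lt by (intro insert.IH grid_upd) auto
  moreover have "x(j := y j) \<in> S \<longleftrightarrow> x \<in> S"
    using insert.prems lt unfolding varies_def by blast
  ultimately show ?case by blast
qed

text \<open>Membership in \<open>S\<close> depends on coordinate \<open>i\<close> only, so
  \<open>S\<close> is a union of blocks in direction \<open>i\<close>.\<close>

lemma varies_one_contains_block:
  assumes "finite I" "i \<in> I" "\<And>j. j \<in> I \<Longrightarrow> j \<noteq> i \<Longrightarrow> \<not> varies I j S"
    and "x \<in> S" "x \<in> grid I"
  shows "block I i (x i) \<subseteq> S"
proof
  fix y assume "y \<in> block I i (x i)"
  then have y: "y \<in> grid I" "y i = x i" by (auto simp: block_def)
  have "x k = y k" if "k \<notin> I - {i}" for k
    using that y assms by (cases "k = i") (auto simp: grid_def PiE_def extensional_def)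
  then show "y \<in> S" using not_varies_agree[of "I - {i}" I S x y] assms y by auto
qed

section \<open>Partitions of the grid into minimal zero-sum sets\<close>

locale grid_zero_sums =
  fixes I :: "nat set" and Z :: "(nat \<Rightarrow> nat) set \<Rightarrow> bool"
  assumes fin: "finite I" and two: "2 \<in> I" and ge2: "I \<subseteq> {2..}"
    and Z_block: "i \<in> I \<Longrightarrow> c < i \<Longrightarrow> Z (block I i c)"
    and Z_exchange: "S \<subseteq> grid I \<Longrightarrow> Z S \<Longrightarrow> exchange I S"
begin

lemma grid_through:
  assumes "i \<in> I" "j \<in> I" "i \<noteq> j" "c < i" "d < j"
  obtains x where "x \<in> grid I" "x i = c" "x j = d"
proof -
  let ?x = "(\<lambda>k. if k \<in> I then 0 else undefined)(i := c, j := d)"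
  have "(\<lambda>k. if k \<in> I then 0 else undefined) \<in> grid I"
    using ge2 by (force simp: grid_def)
  then have "?x \<in> grid I" using assms by (intro grid_upd)
  then show thesis using that[of ?x] assms by simp
qed

lemma block_nonempty:
  assumes "i \<in> I" "c < i"
  obtains x where "x \<in> block I i c"
proof -
  have "(\<lambda>k. if k \<in> I then 0 else undefined) \<in> grid I"
    using ge2 by (force simp: grid_def)
  then have "(\<lambda>k. if k \<in> I then 0 else undefined)(i := c) \<in> block I i c"
    using assms grid_upd by (auto simp: block_def)
  then show thesis by (rule that)
qed

text \<open>A block in direction \<open>i\<close> meets every block in another direction
  \<open>j\<close>, and there are at least two of these because \<open>2 \<le> j\<close>.\<close>

lemma block_subset_block:
  assumes "i \<in> I" "j \<in> I" "c < i" "d < j" "block I i c \<subseteq> block I j d"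
  shows "i = j \<and> c = d"
proof (cases "i = j")
  case True
  with assms block_nonempty[of i c] show ?thesis by (auto simp: block_def)
next
  case False
  have "2 \<le> j" using ge2 assms by auto
  then have "\<exists>d'<j. d' \<noteq> d" by (intro exI[of _ "if d = 0 then 1 else 0"]) auto
  then obtain d' where "d' < j" "d' \<noteq> d" by blast
  then obtain x where "x \<in> grid I" "x i = c" "x j = d'"
    using grid_through assms False by metis
  then show ?thesis using assms \<open>d' \<noteq> d\<close> by (auto simp: block_def)
qed

text \<open>If a smaller \<open>T\<close> varies in two directions, a parallel block, being disjoint
  from \<open>T\<close>, must be its complement, so \<open>T\<close> contains the given block.
  Otherwise \<open>T\<close> contains some block, which can only be the given one.\<close>

lemma minimal_block:
  assumes i: "i \<in> I" "c < i"
  shows "minimal_in Z (block I i c)"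
  unfolding minimal_in_def
proof (intro conjI allI impI notI)
  show "block I i c = {} \<Longrightarrow> False" using block_nonempty i by blast
  show "Z (block I i c)" using Z_block i .
  fix T assume T: "T \<subset> block I i c" "T \<noteq> {}" and "Z T"
  have sub: "T \<subseteq> grid I" using T by (auto simp: block_def)
  with \<open>Z T\<close> have ex: "exchange I T" by (rule Z_exchange[rotated])
  obtain x where x: "x \<in> T" "x \<in> grid I" using T sub by blast
  show False
  proof (cases "\<exists>j\<in>I. \<exists>k\<in>I. j \<noteq> k \<and> varies I j T \<and> varies I k T")
    case True
    then obtain j k where jk: "j \<in> I" "k \<in> I" "j \<noteq> k" "varies I j T" "varies I k T" by blast
    have "2 \<le> i" using ge2 i by auto
    then have "\<exists>c'<i. c' \<noteq> c" by (intro exI[of _ "if c = 0 then 1 else 0"]) auto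
    then obtain c' where c': "c' < i" "c' \<noteq> c" by blast
    then obtain y where "y \<in> block I i c'" using block_nonempty i by blast
    then have "block I i c' = grid I - T"
      using c' T by (intro disjoint_varies_two[OF ex exchange_block[OF i(1)] jk(1-3) jk(4-5)] sub)
        (auto simp: block_def)
    then have "block I i c \<subseteq> T" using c' T by (auto simp: block_def)
    then show False using T by blast
  next
    case False
    \<comment> \<open>If \<open>T\<close> varies in no direction, any element of \<open>I\<close>
      serves, for example 2.\<close>
    then obtain j where j: "j \<in> I" "\<And>k. k \<in> I \<Longrightarrow> k \<noteq> j \<Longrightarrow> \<not> varies I k T" using two by metis
    have "block I j (x j) \<subseteq> T" using varies_one_contains_block[OF fin j x] .
    moreover from this have "j = i \<and> x j = c"
      using T block_subset_block[OF j(1) i(1) _ i(2)] grid_less[OF x(2) j(1)] by blast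
    ultimately show False using T by blast
  qed
qed

lemma partition_blocks:
  assumes "i \<in> I"
  shows "partition_on (grid I) (block I i ` {..<i})" "card (block I i ` {..<i}) = i"
proof -
  show "partition_on (grid I) (block I i ` {..<i})"
  proof (rule partition_onI)
    show "\<Union> (block I i ` {..<i}) = grid I" using assms grid_less by (auto simp: block_def)
    show "{} \<notin> block I i ` {..<i}" using assms block_nonempty by blast
  qed (auto simp: block_def disjnt_def)
  have "inj_on (block I i) {..<i}" using block_subset_block assms by (intro inj_onI) blast
  then show "card (block I i ` {..<i}) = i" by (simp add: card_image)
qed

lemma card_minimal_partition:
  assumes P: "partition_on (grid I) P" and min: "\<And>S. S \<in> P \<Longrightarrow> minimal_in Z S"
  shows "card P \<in> I"
proof -
  have sub: "S \<subseteq> grid I" and ne: "S \<noteq> {}" if "S \<in> P" for S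
    using partition_onD1[OF P] partition_onD3[OF P] that by auto
  have ex: "exchange I S" if "S \<in> P" for S
    using min[OF that] sub[OF that] Z_exchange unfolding minimal_in_def by blast
  have disj: "S \<inter> T = {}" if "S \<in> P" "T \<in> P" "S \<noteq> T" for S T
    using partition_onD2[OF P] that unfolding disjoint_def by blast
  have gne: "grid I \<noteq> {}" using block_nonempty[OF two, of 0] by (auto simp: block_def)
  show ?thesis
  proof (cases "\<exists>S\<in>P. \<exists>j\<in>I. \<exists>k\<in>I. j \<noteq> k \<and> varies I j S \<and> varies I k S")
    case True
    then obtain S j k where S: "S \<in> P"
      and jk: "j \<in> I" "k \<in> I" "j \<noteq> k" "varies I j S" "varies I k S" by blast
    have "S \<noteq> grid I" using jk(1,4) grid_upd unfolding varies_def by blast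
    have "T = grid I - S" if "T \<in> P" "T \<noteq> S" for T
      using disjoint_varies_two[OF ex[OF S] ex[OF that(1)] jk] disj[OF S that(1)] that sub ne S
      by blast
    moreover have "\<exists>T\<in>P. T \<noteq> S" using partition_onD1[OF P] \<open>S \<noteq> grid I\<close> S by blast
    ultimately have "P = {S, grid I - S}" using S by blast
    moreover have "S \<noteq> grid I - S" using ne[OF S] by blast
    ultimately have "card P = 2" by simp
    then show ?thesis using two by simp
  next
    case False
    have bl: "\<exists>i\<in>I. \<exists>c<i. S = block I i c" if S: "S \<in> P" for S
    proof -
      obtain j where j: "j \<in> I" "\<And>k. k \<in> I \<Longrightarrow> k \<noteq> j \<Longrightarrow> \<not> varies I k S"
        using False S two by metis
      obtain x where x: "x \<in> S" "x \<in> grid I" using ne[OF S] sub[OF S] by blast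
      have "block I j (x j) \<subseteq> S" using varies_one_contains_block[OF fin j x] .
      moreover have lt: "x j < j" using x j grid_less by blast
      moreover have "block I j (x j) \<noteq> {}" using x by (auto simp: block_def)
      \<comment> \<open>A minimal set that contains a zero-sum block equals it.\<close>
      ultimately have "block I j (x j) = S"
        using min[OF S] Z_block[OF j(1) lt] unfolding minimal_in_def psubset_eq by metis
      then show ?thesis using j lt by blast
    qed
    obtain S where S: "S \<in> P" using gne partition_onD1[OF P] by blast
    then obtain i c where i: "i \<in> I" "c < i" "S = block I i c" using bl by blast
    have sub_i: "\<exists>d<i. T = block I i d" if T: "T \<in> P" for T
    proof -
      obtain j d where j: "j \<in> I" "d < j" "T = block I j d" using bl T by blast
      have "j = i"
      proof (rule ccontr)
        assume "j \<noteq> i"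
        then obtain x where x: "x \<in> grid I" "x i = c" "x j = d" using grid_through i j by metis
        then have "x \<in> S \<inter> T" using i j by (simp add: block_def)
        then have "S = T" using disj S T by blast
        then show False using block_subset_block[OF i(1) j(1) i(2) j(2)] i j \<open>j \<noteq> i\<close> by auto
      qed
      then show ?thesis using j by blast
    qed
    have "P = block I i ` {..<i}"
    proof
      show "P \<subseteq> block I i ` {..<i}" using sub_i by blast
      show "block I i ` {..<i} \<subseteq> P"
      proof clarify
        fix d assume "d < i"
        then obtain x where x: "x \<in> block I i d" using block_nonempty i by blast
        then obtain T where T: "T \<in> P" "x \<in> T" using partition_onD1[OF P] by (auto simp: block_def)
        then show "block I i d \<in> P" using sub_i[OF T(1)] x by (auto simp: block_def)
      qed
    qed
    then show ?thesis using partition_blocks i by simp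
  qed
qed

theorem minimal_partition_cards:
  "{card P | P. partition_on (grid I) P \<and> (\<forall>S\<in>P. minimal_in Z S)} = I"
proof
  show "{card P | P. partition_on (grid I) P \<and> (\<forall>S\<in>P. minimal_in Z S)} \<subseteq> I"
    using card_minimal_partition by blast
  show "I \<subseteq> {card P | P. partition_on (grid I) P \<and> (\<forall>S\<in>P. minimal_in Z S)}"
  proof
    fix i assume i: "i \<in> I"
    have "\<forall>S\<in>block I i ` {..<i}. minimal_in Z S" using minimal_block i by blast
    then show "i \<in> {card P | P. partition_on (grid I) P \<and> (\<forall>S\<in>P. minimal_in Z S)}"
      using partition_blocks[OF i] by force
  qed
qed

end

subsection \<open>Independence modulo 2 in large groups\<close>

context comm_group
begin

text \<open>Dividing by one fixed square root of \<open>t\<close> embeds the set of all square roots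
  of \<open>t\<close> into the 2-torsion.\<close>

lemma card_square_preimage_le:
  assumes fin: "finite (carrier G)" and "finite T" and K: "card {g \<in> carrier G. g \<otimes> g = \<one>} \<le> m"
  shows "card {g \<in> carrier G. g \<otimes> g \<in> T} \<le> card T * m"
proof -
  let ?fib = "\<lambda>t. {g \<in> carrier G. g \<otimes> g = t}"
  have fib: "card (?fib t) \<le> m" for t
  proof (cases "?fib t = {}")
    case False
    then obtain h where h: "h \<in> carrier G" "h \<otimes> h = t" by blast
    have "card (?fib t) \<le> card {g \<in> carrier G. g \<otimes> g = \<one>}"
    proof (rule card_inj_on_le)
      show "inj_on (\<lambda>g. g \<otimes> inv h) (?fib t)" using h by (auto intro!: inj_onI)
      show "(\<lambda>g. g \<otimes> inv h) ` ?fib t \<subseteq> {g \<in> carrier G. g \<otimes> g = \<one>}"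
      proof clarify
        fix g assume g: "g \<in> carrier G" "t = g \<otimes> g"
        have "(g \<otimes> inv h) \<otimes> (g \<otimes> inv h) = (g \<otimes> g) \<otimes> inv (h \<otimes> h)"
          using g h(1) by (simp add: inv_mult m_ac)
        also have "\<dots> = \<one>" using g h by (metis m_closed r_inv)
        finally show "g \<otimes> inv h \<in> carrier G \<and> (g \<otimes> inv h) \<otimes> (g \<otimes> inv h) = \<one>"
          using g h by simp
      qed
    qed (use fin in auto)
    then show ?thesis using K by linarith
  next
    case True
    show ?thesis unfolding True by simp
  qed
  have "{g \<in> carrier G. g \<otimes> g \<in> T} = (\<Union>t\<in>T. ?fib t)" by auto
  then have "card {g \<in> carrier G. g \<otimes> g \<in> T} \<le> (\<Sum>t\<in>T. card (?fib t))"
    using card_UN_le[OF \<open>finite T\<close>, of ?fib] by simp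
  also have "\<dots> \<le> card T * m" using sum_bounded_above[of T "\<lambda>t. card (?fib t)" m] fib by simp
  finally show ?thesis .
qed

text \<open>
  Either the 2-torsion has more than \<open>m\<close> elements and contains a suitable \<open>g\<close>, or each element has at
  most \<open>m\<close> square roots.
\<close>

lemma exists_avoiding:
  assumes fin: "finite (carrier G)" and big: "card (carrier G) > m * m + m"
    and T: "finite T" "card T \<le> m"
  shows "\<exists>g \<in> carrier G. g \<notin> T \<and> (g \<otimes> g = \<one> \<or> g \<otimes> g \<notin> T)"
proof (rule ccontr)
  assume none: "\<not> ?thesis"
  let ?K = "{g \<in> carrier G. g \<otimes> g = \<one>}"
  have "?K \<subseteq> T" using none by blast
  then have K: "card ?K \<le> m" using T card_mono by (meson order_trans)
  have "carrier G \<subseteq> T \<union> {g \<in> carrier G. g \<otimes> g \<in> T}" using none by blast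
  then have "card (carrier G) \<le> card (T \<union> {g \<in> carrier G. g \<otimes> g \<in> T})"
    using T fin by (intro card_mono) auto
  also have "\<dots> \<le> card T + card T * m"
    using card_Un_le card_square_preimage_le[OF fin T(1) K] by (meson add_left_mono order_trans)
  also have "\<dots> \<le> m + m * m" using T by (intro add_mono mult_right_mono) auto
  finally show False using big by simp
qed

text \<open>Induction on \<open>R\<close>: at most \<open>5 ^ card R\<close> elements are
  combinations of the earlier \<open>E r\<close> with coefficients in {-2..2}, and
  \<open>exists_avoiding\<close> for this set supplies the next element.\<close>

lemma exists_parity_independent:
  assumes fin: "finite (carrier G)" and "finite R"
    and big: "card (carrier G) > 5 ^ card R * 5 ^ card R + 5 ^ card R"
  shows "\<exists>E. E \<in> R \<rightarrow> carrier G \<and>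
    (\<forall>v :: 'r \<Rightarrow> int. (\<forall>r\<in>R. \<bar>v r\<bar> \<le> 2) \<longrightarrow> (\<Otimes>r\<in>R. E r [^] v r) = \<one> \<longrightarrow> (\<forall>r\<in>R. even (v r)))"
  using \<open>finite R\<close> big
proof (induction R rule: finite_induct)
  case empty
  then show ?case by simp
next
  case (insert s R)
  have le: "(5::nat) ^ card R \<le> 5 ^ card (insert s R)" using insert.hyps by simp
  then have "(5::nat) ^ card R * 5 ^ card R + 5 ^ card R
      \<le> 5 ^ card (insert s R) * 5 ^ card (insert s R) + 5 ^ card (insert s R)"
    by (intro add_mono mult_mono) auto
  then obtain E where E: "E \<in> R \<rightarrow> carrier G" and
    ind: "\<And>v :: 'r \<Rightarrow> int. \<forall>r\<in>R. \<bar>v r\<bar> \<le> 2 \<Longrightarrow> (\<Otimes>r\<in>R. E r [^] v r) = \<one> \<Longrightarrow> \<forall>r\<in>R. even (v r)"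
    using insert.IH insert.prems by (meson le_less_trans)
  define pr where "pr v = (\<Otimes>r\<in>R. E r [^] v r)" for v :: "'r \<Rightarrow> int"
  define V where "V = (\<Pi>\<^sub>E r\<in>R. {-2..2::int})"
  have Ec: "r \<in> R \<Longrightarrow> E r \<in> carrier G" for r using E by blast
  have pr_in: "pr v \<in> carrier G" for v unfolding pr_def using Ec by (intro finprod_closed) auto
  have prV: "pr v \<in> pr ` V" if "\<forall>r\<in>R. \<bar>v r\<bar> \<le> 2" for v
  proof -
    have "pr v = pr (restrict v R)" unfolding pr_def using Ec by (intro finprod_cong') auto
    moreover have "restrict v R \<in> V" using that unfolding V_def by (auto simp: abs_le_iff)
    ultimately show ?thesis by blast
  qed
  \<comment> \<open>The set of combinations is closed under inverses, so both signs of the new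
    coefficient are covered.\<close>
  have pr_neg: "pr (\<lambda>r. - v r) = inv (pr v)" for v
  proof -
    have "pr (\<lambda>r. - v r) \<otimes> pr v = \<one>"
      unfolding pr_def using Ec
      by (subst finprod_multf[symmetric]) (auto simp: int_pow_neg cong: finprod_cong)
    then show ?thesis using pr_in inv_equality by simp
  qed
  have "finite V" unfolding V_def using insert.hyps by (intro finite_PiE) auto
  moreover have "card V = 5 ^ card R" unfolding V_def using insert.hyps by (simp add: card_PiE)
  ultimately have "finite (pr ` V)" "card (pr ` V) \<le> 5 ^ card (insert s R)"
    using order_trans[OF card_image_le[of V pr]] le by auto
  then obtain g where g: "g \<in> carrier G" "g \<notin> pr ` V" "g \<otimes> g = \<one> \<or> g \<otimes> g \<notin> pr ` V"
    using exists_avoiding[OF fin insert.prems] by blast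
  let ?E = "E(s := g)"
  have "\<forall>r\<in>insert s R. even (v r)"
    if v: "\<forall>r\<in>insert s R. \<bar>v r\<bar> \<le> 2" and one: "(\<Otimes>r\<in>insert s R. ?E r [^] v r) = \<one>"
    for v :: "'r \<Rightarrow> int"
  proof -
    have "(\<Otimes>r\<in>R. ?E r [^] v r) = pr v"
      unfolding pr_def using insert.hyps Ec by (intro finprod_cong') auto
    then have eq: "g [^] v s \<otimes> pr v = \<one>"
      using one insert.hyps g Ec by (subst (asm) finprod_insert) auto
    have vR: "pr v \<in> pr ` V" "inv (pr v) \<in> pr ` V"
      using prV[of v] prV[of "\<lambda>r. - v r"] v pr_neg by auto
    have eq1: "g [^] v s = inv (pr v)" using eq g pr_in by (simp add: inv_equality)
    then have "inv (g [^] v s) = pr v" using pr_in by simp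
    then have eq2: "g [^] (- v s) = pr v" using g by (simp add: int_pow_neg)
    have sq: "g [^] (2::int) = g \<otimes> g"
      using int_pow_mult[OF g(1), of 1 1] g(1) by simp
    \<comment> \<open>Coefficients 1 and -1 would make \<open>g\<close> an earlier combination; 2
      and -2 make \<open>g \<otimes> g\<close> one, which forces it to be neutral. So the new factor
      is trivial and the induction hypothesis applies to the rest.\<close>
    have "v s \<in> {-2, -1, 0, 1, 2}" using v by auto
    moreover have "v s \<noteq> 1" using eq1 g vR by (metis int_pow_1)
    moreover have "v s \<noteq> -1" using eq2 g vR by (metis int_pow_1 minus_minus)
    moreover have "g \<otimes> g = \<one>" if "v s = 2 \<or> v s = -2"
    proof -
      have "g \<otimes> g \<in> pr ` V" using that eq1 eq2 vR sq by (metis minus_minus)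
      then show ?thesis using g by blast
    qed
    ultimately have "even (v s)" "g [^] v s = \<one>"
      using sq g by (auto simp: int_pow_neg)
    moreover from this have "pr v = \<one>" using eq pr_in by simp
    then have "\<forall>r\<in>R. even (v r)" using ind[of v] v unfolding pr_def by blast
    ultimately show ?thesis by blast
  qed
  moreover have "?E \<in> insert s R \<rightarrow> carrier G" using Ec g by auto
  ultimately show ?case by blast
qed

end

subsection \<open>Factorizations as partitions\<close>

lemma mset_set_split: "finite A \<Longrightarrow> T \<subseteq> A \<Longrightarrow> mset_set A = mset_set T + mset_set (A - T)"
  by (metis Diff_disjoint Diff_partition finite_Diff finite_subset mset_set_Union)

text \<open>All multiplicities in \<open>mset_set A\<close> are at most 1, so each summand is
  determined by its support.\<close>

lemma mset_set_eq_plusE: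
  assumes "mset_set A = B + C" "finite A"
  obtains T where "T \<subseteq> A" "B = mset_set T" "C = mset_set (A - T)"
proof -
  have cnt: "count B x + count C x = (if x \<in> A then 1 else 0)" for x
    using arg_cong[OF assms(1), of "\<lambda>M. count M x"] assms(2) by (simp add: count_mset_set')
  have T: "set_mset B \<subseteq> A" using cnt by (metis add_is_0 not_in_iff subsetI)
  have B: "B = mset_set (set_mset B)"
  proof (rule multiset_eqI)
    fix x
    have "count B x \<le> 1" using cnt[of x] by (auto split: if_splits)
    then show "count B x = count (mset_set (set_mset B)) x"
      by (cases "x \<in># B") (auto simp: not_in_iff Suc_le_eq order_antisym)
  qed
  moreover have "C = mset_set (A - set_mset B)"
    using mset_set_split[OF assms(2) T] B assms(1) by (metis add_left_cancel)
  ultimately show thesis using that T by blast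
qed

context comm_group
begin

lemma seq_sum_superset:
  assumes "finite A" "set_mset S \<subseteq> A" "A \<subseteq> carrier G"
  shows "seq_sum G S = (\<Otimes>g\<in>A. g [^] count S g)"
  unfolding seq_sum_def
  by (rule finprod_mono_neutral_cong_left) (use assms in \<open>auto simp: not_in_iff\<close>)

lemma seq_sum_union:
  assumes "set_mset S \<subseteq> carrier G" "set_mset T \<subseteq> carrier G"
  shows "seq_sum G (S + T) = seq_sum G S \<otimes> seq_sum G T"
proof -
  let ?A = "set_mset S \<union> set_mset T"
  have c: "(\<lambda>g. g [^] count U g) \<in> ?A \<rightarrow> carrier G" for U using assms by auto
  have "seq_sum G (S + T) = (\<Otimes>g\<in>?A. g [^] count S g \<otimes> g [^] count T g)"
    unfolding seq_sum_superset[of ?A "S + T", OF _ _ Un_least[OF assms], simplified]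
    using assms by (intro finprod_cong') (auto simp: nat_pow_mult)
  then show ?thesis
    using seq_sum_superset[of ?A S] seq_sum_superset[of ?A T] assms c by (simp add: finprod_multf)
qed

lemma seq_sum_closed: "set_mset S \<subseteq> carrier G \<Longrightarrow> seq_sum G S \<in> carrier G"
  unfolding seq_sum_def by (intro finprod_closed) auto

lemma seq_sum_single: "g \<in> carrier G \<Longrightarrow> seq_sum G {#g#} = g"
  by (simp add: seq_sum_def)

lemma seq_sum_image_mset_set:
  assumes "finite A" "\<phi> \<in> A \<rightarrow> carrier G"
  shows "seq_sum G (image_mset \<phi> (mset_set A)) = finprod G \<phi> A"
  using assms
proof (induction A rule: finite_induct)
  case empty
  then show ?case by (simp add: seq_sum_def)
next
  case (insert a A)
  have "seq_sum G ({#\<phi> a#} + image_mset \<phi> (mset_set A)) = \<phi> a \<otimes> finprod G \<phi> A"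
    using insert by (subst seq_sum_union) (auto simp: seq_sum_single)
  then show ?case using insert by (simp add: Pi_iff)
qed

lemma zero_sum_image_iff:
  assumes "finite A" "\<phi> \<in> A \<rightarrow> carrier G"
  shows "image_mset \<phi> (mset_set A) \<in> carrier (zero_sum_monoid G) \<longleftrightarrow> finprod G \<phi> A = \<one>"
  using assms seq_sum_image_mset_set[OF assms] by (auto simp: zero_sum_monoid_def)

text \<open>The points of \<open>A\<close> serve as labels for the terms. Although
  \<open>\<phi>\<close> may repeat values, every splitting of the image multiset lifts to a
  splitting of the set of labels.\<close>

lemma atom_image_iff:
  assumes "finite A" and \<phi>: "\<phi> \<in> A \<rightarrow> carrier G"
  shows "image_mset \<phi> (mset_set A) \<in> zero_sum_atoms G \<longleftrightarrow>
    minimal_in (\<lambda>S. finprod G \<phi> S = \<one>) A"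
proof -
  have sub: "finite T" "\<phi> \<in> T \<rightarrow> carrier G" if "T \<subseteq> A" for T
    using that assms finite_subset by auto
  have "(\<exists>B C. B \<in> carrier (zero_sum_monoid G) \<and> C \<in> carrier (zero_sum_monoid G) \<and>
            B \<noteq> {#} \<and> C \<noteq> {#} \<and> image_mset \<phi> (mset_set A) = B + C)
      \<longleftrightarrow> (\<exists>T. T \<subset> A \<and> T \<noteq> {} \<and> finprod G \<phi> T = \<one>)" (is "?L \<longleftrightarrow> ?R")
    if one: "finprod G \<phi> A = \<one>"
  proof
    assume ?L
    then obtain B C where BC: "B \<in> carrier (zero_sum_monoid G)" "B \<noteq> {#}" "C \<noteq> {#}"
      "image_mset \<phi> (mset_set A) = B + C" by blast
    then obtain B' C' where BC': "mset_set A = B' + C'" "B = image_mset \<phi> B'"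
      "C = image_mset \<phi> C'" using image_mset_eq_plusD by metis
    then obtain T where T: "T \<subseteq> A" and B': "B' = mset_set T" "C' = mset_set (A - T)"
      using mset_set_eq_plusE assms(1) by metis
    have "T \<noteq> A" using BC' B' BC(3) by auto
    moreover have "T \<noteq> {}" using BC' B' BC(2) by auto
    moreover have "finprod G \<phi> T = \<one>"
      using zero_sum_image_iff[OF sub[OF T]] BC(1) BC'(2) B' by simp
    ultimately show ?R using T by blast
  next
    assume ?R
    then obtain T where T: "T \<subset> A" "T \<noteq> {}" "finprod G \<phi> T = \<one>" by blast
    then have TA: "T \<subseteq> A" by blast
    have "finprod G \<phi> A = finprod G \<phi> T \<otimes> finprod G \<phi> (A - T)"
      using finprod_Un_disjoint[of T "A - T" \<phi>] sub[OF TA] sub[of "A - T"] TA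
      by (simp add: Un_absorb1)
    then have "finprod G \<phi> (A - T) = \<one>" using one T sub[of "A - T"] by simp
    then have "image_mset \<phi> (mset_set T) \<in> carrier (zero_sum_monoid G)"
      "image_mset \<phi> (mset_set (A - T)) \<in> carrier (zero_sum_monoid G)"
      using zero_sum_image_iff sub[OF TA] sub[of "A - T"] T by auto
    moreover have "image_mset \<phi> (mset_set T) \<noteq> {#}" "image_mset \<phi> (mset_set (A - T)) \<noteq> {#}"
      using T sub[OF TA] assms by (auto simp: mset_set_empty_iff)
    moreover have "image_mset \<phi> (mset_set A)
        = image_mset \<phi> (mset_set T) + image_mset \<phi> (mset_set (A - T))"
      using mset_set_split[OF assms(1) TA] by simp
    ultimately show ?L by blast
  qed
  then show ?thesis
    unfolding zero_sum_atoms_iff minimal_in_def zero_sum_image_iff[OF assms]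
    using assms(1) by (auto simp: mset_set_empty_iff)
qed

lemma sum_mset_image_partition:
  assumes "finite X" "partition_on X P"
  shows "(\<Sum>S\<in>#mset_set P. image_mset \<phi> (mset_set S)) = image_mset \<phi> (mset_set X)"
proof -
  have "finite P" using assms finite_elements by blast
  then show ?thesis using assms
  proof (induction P arbitrary: X rule: finite_induct)
    case empty
    then show ?case by (simp add: partition_on_def)
  next
    case (insert S P)
    have dj: "disjnt S (\<Union>P)"
      using partition_onD2[OF insert.prems(2)] insert.hyps
      by (auto simp: disjoint_def disjnt_def)
    then have P: "partition_on (X - S) P" "S \<subseteq> X"
      using insert.prems(2) partition_on_insert by blast+
    have "mset_set X = mset_set S + mset_set (X - S)"
      using mset_set_split insert.prems(1) P(2) .
    then show ?case using insert.IH[OF _ P(1)] insert by simp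
  qed
qed

text \<open>Factors are lifted one by one. Equal factors come from different parts, since nonempty
  disjoint sets are distinct.\<close>

lemma factorization_lifts_to_partition:
  assumes "finite X" "image_mset \<phi> (mset_set X) = \<Sum>\<^sub># F" "{#} \<notin># F"
  shows "\<exists>P. partition_on X P \<and> F = image_mset (\<lambda>S. image_mset \<phi> (mset_set S)) (mset_set P)"
  using assms
proof (induction F arbitrary: X)
  case empty
  then have "X = {}" by (simp add: mset_set_empty_iff)
  then show ?case by (intro exI[of _ "{}"]) (simp add: partition_on_def)
next
  case (add B F)
  then have "image_mset \<phi> (mset_set X) = B + \<Sum>\<^sub># F" by simp
  then obtain B' C' where BC': "mset_set X = B' + C'" "B = image_mset \<phi> B'"
    "\<Sum>\<^sub># F = image_mset \<phi> C'" using image_mset_eq_plusD by blast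
  then obtain S where S: "S \<subseteq> X" and B': "B' = mset_set S" and C': "C' = mset_set (X - S)"
    using mset_set_eq_plusE add.prems(1) by metis
  then obtain P where P: "partition_on (X - S) P"
    "F = image_mset (\<lambda>S. image_mset \<phi> (mset_set S)) (mset_set P)"
    using add.IH[of "X - S"] add.prems BC'(3) C' by auto
  have "S \<noteq> {}" using add.prems(3) BC'(2) B' by auto
  moreover have dj: "disjnt S (\<Union>P)" using partition_onD1[OF P(1)] by (auto simp: disjnt_def)
  ultimately have "partition_on X (insert S P)" using P S partition_on_insert[OF dj] by simp
  moreover have "S \<notin> P" using \<open>S \<noteq> {}\<close> dj by (auto simp: disjnt_def)
  moreover have "finite P" using P(1) add.prems(1) finite_elements by blast
  ultimately show ?case using P(2) BC'(2) B' by (intro exI[of _ "insert S P"]) simp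
qed

text \<open>Turns the computation of a set of lengths into the combinatorics of partitions of
  \<open>X\<close>.\<close>

lemma length_set_image:
  assumes "finite X" and \<phi>: "\<phi> \<in> X \<rightarrow> carrier G"
  shows "length_set G (image_mset \<phi> (mset_set X)) =
    {card P | P. partition_on X P \<and> (\<forall>S\<in>P. minimal_in (\<lambda>S. finprod G \<phi> S = \<one>) S)}"
    (is "_ = ?R")
proof -
  have atom: "image_mset \<phi> (mset_set S) \<in> zero_sum_atoms G \<longleftrightarrow>
      minimal_in (\<lambda>S. finprod G \<phi> S = \<one>) S"
    if "S \<in> P" "partition_on X P" for S P
    using that assms partition_onD1[OF that(2)] by (intro atom_image_iff) (auto intro: finite_subset)
  show ?thesis
  proof (intro subset_antisym subsetI)
    fix k assume "k \<in> length_set G (image_mset \<phi> (mset_set X))"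
    then obtain F where F: "set_mset F \<subseteq> zero_sum_atoms G" "size F = k"
      "image_mset \<phi> (mset_set X) = \<Sum>\<^sub># F" unfolding length_set_def by force
    have "{#} \<notin># F" using F(1) zero_sum_atoms_iff by blast
    then obtain P where P: "partition_on X P"
      "F = image_mset (\<lambda>S. image_mset \<phi> (mset_set S)) (mset_set P)"
      using factorization_lifts_to_partition[OF assms(1) F(3)] by blast
    have "finite P" using P assms finite_elements by blast
    then have "card P = k" "\<forall>S\<in>P. minimal_in (\<lambda>S. finprod G \<phi> S = \<one>) S"
      using F P atom[OF _ P(1)] by auto
    then show "k \<in> ?R" using P by blast
  next
    fix k assume "k \<in> ?R"
    then obtain P where P: "partition_on X P" "k = card P"
      "\<forall>S\<in>P. minimal_in (\<lambda>S. finprod G \<phi> S = \<one>) S" by blast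
    have "finite P" using P assms finite_elements by blast
    then show "k \<in> length_set G (image_mset \<phi> (mset_set X))"
      unfolding length_set_def using P atom[OF _ P(1)] sum_mset_image_partition[OF assms(1) P(1)]
      by (intro CollectI exI[of _ "image_mset (\<lambda>S. image_mset \<phi> (mset_set S)) (mset_set P)"]) auto
  qed
qed

section \<open>Shifting sets of lengths by neutral terms\<close>

lemma zero_sum_add_one:
  assumes "A \<in> carrier (zero_sum_monoid G)"
  shows "add_mset \<one> A \<in> carrier (zero_sum_monoid G)"
  using assms seq_sum_union[of "{#\<one>#}" A] by (auto simp: zero_sum_monoid_def seq_sum_single)

lemma zero_sum_remove_one:
  assumes "add_mset \<one> A \<in> carrier (zero_sum_monoid G)"
  shows "A \<in> carrier (zero_sum_monoid G)"
  using assms seq_sum_union[of "{#\<one>#}" A] seq_sum_closed[of A]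
  by (auto simp: zero_sum_monoid_def seq_sum_single)

lemma one_atom: "{#\<one>#} \<in> zero_sum_atoms G"
  unfolding zero_sum_atoms_iff
  using zero_sum_add_one[OF empty_in_zero_sum_monoid] by (auto simp: single_is_union)

lemma atom_containing_one:
  assumes B: "B \<in> zero_sum_atoms G" and "\<one> \<in># B"
  shows "B = {#\<one>#}"
proof -
  obtain C where C: "B = add_mset \<one> C" using assms(2) by (metis mset_add)
  then have "C \<in> carrier (zero_sum_monoid G)"
    using B zero_sum_remove_one zero_sum_atoms_iff by blast
  moreover have "{#\<one>#} \<in> carrier (zero_sum_monoid G)" using one_atom zero_sum_atoms_iff by blast
  ultimately have "C = {#}" using B C unfolding zero_sum_atoms_iff
    by (metis add_mset_add_single add.commute add_mset_not_empty)
  then show ?thesis using C by simp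
qed

text \<open>The only atom containing \<open>\<one>\<close> is \<open>{#\<one>#}\<close>, so every
  factorization of the larger sequence has this factor, and removing it gives a factorization of
  \<open>A\<close>.\<close>

lemma length_set_add_one: "length_set G (add_mset \<one> A) = Suc ` length_set G A"
proof (intro subset_antisym subsetI)
  fix k assume "k \<in> length_set G (add_mset \<one> A)"
  then obtain F where F: "set_mset F \<subseteq> zero_sum_atoms G" "size F = k" "\<Sum>\<^sub># F = add_mset \<one> A"
    unfolding length_set_def by blast
  have "\<one> \<in># \<Sum>\<^sub># F" using F by simp
  then obtain B where B: "B \<in># F" "\<one> \<in># B" by auto
  then have "B = {#\<one>#}" using F atom_containing_one by blast
  then obtain F' where F': "F = add_mset {#\<one>#} F'" using B mset_add by metis
  then have "size F' \<in> length_set G A" using F unfolding length_set_def by auto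
  then show "k \<in> Suc ` length_set G A" using F F' by auto
next
  fix k assume "k \<in> Suc ` length_set G A"
  then obtain F where F: "set_mset F \<subseteq> zero_sum_atoms G" "k = Suc (size F)" "\<Sum>\<^sub># F = A"
    unfolding length_set_def by blast
  then show "k \<in> length_set G (add_mset \<one> A)"
    unfolding length_set_def using one_atom
    by (intro CollectI exI[of _ "add_mset {#\<one>#} F"]) auto
qed

lemma length_sets_system_shift:
  assumes "L \<in> length_sets_system G"
  shows "(\<lambda>l. l + s) ` L \<in> length_sets_system G"
proof (induction s)
  case 0
  then show ?case using assms by simp
next
  case (Suc s)
  then obtain A where A: "A \<in> carrier (zero_sum_monoid G)" "(\<lambda>l. l + s) ` L = length_set G A"
    unfolding length_sets_system_def by blast
  have "(\<lambda>l. l + Suc s) ` L = Suc ` (\<lambda>l. l + s) ` L" by (simp add: image_image)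
  then have "(\<lambda>l. l + Suc s) ` L = length_set G (add_mset \<one> A)"
    using A length_set_add_one by simp
  then show ?case using zero_sum_add_one[OF A(1)] unfolding length_sets_system_def by blast
qed

section \<open>Realizing a set of lengths with minimum 2\<close>

lemma finprod_int_pow_sum:
  assumes "finite S" "finite R" "E \<in> R \<rightarrow> carrier G"
  shows "(\<Otimes>z\<in>S. \<Otimes>r\<in>R. E r [^] (c r z :: int)) = (\<Otimes>r\<in>R. E r [^] (\<Sum>z\<in>S. c r z))"
  using assms(1)
proof (induction S rule: finite_induct)
  case empty
  then show ?case by (simp add: finprod_one_eqI)
next
  case (insert a S)
  have E: "r \<in> R \<Longrightarrow> E r \<in> carrier G" for r using assms by blast
  have "(\<Otimes>z\<in>insert a S. \<Otimes>r\<in>R. E r [^] c r z)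
      = (\<Otimes>r\<in>R. E r [^] c r a) \<otimes> (\<Otimes>r\<in>R. E r [^] (\<Sum>z\<in>S. c r z))"
    using insert E by (subst finprod_insert) auto
  also have "\<dots> = (\<Otimes>r\<in>R. E r [^] c r a \<otimes> E r [^] (\<Sum>z\<in>S. c r z))"
    using E by (intro finprod_multf[symmetric]) auto
  also have "\<dots> = (\<Otimes>r\<in>R. E r [^] (\<Sum>z\<in>insert a S. c r z))"
    using E insert by (intro finprod_cong') (auto simp: int_pow_mult)
  finally show ?case .
qed

text \<open>The product of \<open>\<phi>\<close> over \<open>S\<close> is the combination of the
  \<open>E r\<close> whose coefficients measure by how much \<open>S\<close> violates the exchange
  relations. Zero violation makes it neutral; conversely, if it is neutral, parity independence
  makes every violation even.\<close>

lemma length_sets_system_two: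
  assumes fin: "finite (carrier G)" and I: "finite I" "2 \<in> I" "I \<subseteq> {2..}"
    and N: "N = 5 ^ card (I \<times> grid I \<times> grid I)" and big: "card (carrier G) > N * N + N"
  shows "I \<in> length_sets_system G"
proof -
  let ?X = "grid I" and ?R = "I \<times> grid I \<times> grid I"
  have finX: "finite ?X" and finR: "finite ?R" using I finite_grid by auto
  obtain E where E: "E \<in> ?R \<rightarrow> carrier G" and
    ind: "\<And>v :: _ \<Rightarrow> int. \<forall>r\<in>?R. \<bar>v r\<bar> \<le> 2 \<Longrightarrow> (\<Otimes>r\<in>?R. E r [^] v r) = \<one> \<Longrightarrow> \<forall>r\<in>?R. even (v r)"
    using exists_parity_independent[OF fin finR] big N by blast
  \<comment> \<open>One element \<open>E r\<close> for each exchange relation \<open>r\<close>, with the coefficient of \<open>z\<close> in that relation.\<close>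
  define c :: "nat \<times> (nat \<Rightarrow> nat) \<times> (nat \<Rightarrow> nat) \<Rightarrow> (nat \<Rightarrow> nat) \<Rightarrow> int" where
    "c = (\<lambda>(i, x, y) z. of_bool (z = x) + of_bool (z = y)
      - of_bool (z = x(i := y i)) - of_bool (z = y(i := x i)))"
  define \<phi> where "\<phi> z = (\<Otimes>r\<in>?R. E r [^] c r z)" for z
  have \<phi>: "\<phi> \<in> S \<rightarrow> carrier G" for S unfolding \<phi>_def using E by (auto intro!: finprod_closed)
  have csum: "(\<Sum>z\<in>S. c (i, x, y) z) = of_bool (x \<in> S) + of_bool (y \<in> S)
      - of_bool (x(i := y i) \<in> S) - of_bool (y(i := x i) \<in> S)" if "finite S" for S i x y
    using that by (simp add: c_def sum.distrib sum_subtractf of_bool_def sum.delta)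
  have prod: "finprod G \<phi> S = (\<Otimes>r\<in>?R. E r [^] (\<Sum>z\<in>S. c r z))" if "S \<subseteq> ?X" for S
    unfolding \<phi>_def using that finX finR E finite_subset by (intro finprod_int_pow_sum) auto
  interpret grid_zero_sums I "\<lambda>S. finprod G \<phi> S = \<one>"
  proof
    fix i e assume i: "i \<in> I" "e < i"
    have sub: "block I i e \<subseteq> ?X" by (auto simp: block_def)
    \<comment> \<open>An exchange in any direction preserves the multiset of the two
      \<open>i\<close>-coordinates, so blocks satisfy the relations over the integers.\<close>
    have "(\<Sum>z\<in>block I i e. c r z) = 0" if r: "r \<in> ?R" for r
    proof -
      obtain j x y where r': "r = (j, x, y)" by (cases r)
      then have "x(j := y j) \<in> ?X" "y(j := x j) \<in> ?X" using r grid_upd grid_less by auto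
      then show ?thesis
        using r unfolding r' csum[OF finite_subset[OF sub finX]]
        by (auto simp: block_def)
    qed
    then show "finprod G \<phi> (block I i e) = \<one>"
      unfolding prod[OF sub] by (intro finprod_one_eqI) simp
  next
    fix S assume S: "S \<subseteq> ?X" and one: "finprod G \<phi> S = \<one>"
    have finS: "finite S" using S finX finite_subset by blast
    \<comment> \<open>Two indicator values minus two others: this is where the coefficient bound 2
      comes from.\<close>
    have "\<bar>\<Sum>z\<in>S. c r z\<bar> \<le> 2" for r
      by (cases r) (auto simp: csum[OF finS])
    moreover have "(\<Otimes>r\<in>?R. E r [^] (\<Sum>z\<in>S. c r z)) = \<one>" using one prod[OF S] by simp
    ultimately have "\<forall>r\<in>?R. even (\<Sum>z\<in>S. c r z)"
      using ind[of "\<lambda>r. \<Sum>z\<in>S. c r z"] by blast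
    then have "even (\<Sum>z\<in>S. c (i, x, y) z)" if "i \<in> I" "x \<in> ?X" "y \<in> ?X" for i x y
      using that by blast
    then have "((x \<in> S) = (y \<in> S)) = ((x(i := y i) \<in> S) = (y(i := x i) \<in> S))"
      if "i \<in> I" "x \<in> ?X" "y \<in> ?X" for i x y
      using that unfolding csum[OF finS] by (fastforce simp: of_bool_def split: if_splits)
    then show "exchange I S" unfolding exchange_def by blast
  qed (use I in auto)
  let ?A = "image_mset \<phi> (mset_set ?X)"
  have "length_set G ?A = I"
    using length_set_image[OF finX \<phi>] minimal_partition_cards by simp
  moreover have "finprod G \<phi> ?X = \<one>"
  proof -
    have "(\<Sum>z\<in>?X. c r z) = 0" if r: "r \<in> ?R" for r
      using r by (cases r) (auto simp: csum[OF finX] grid_upd grid_less)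
    then show ?thesis unfolding prod[OF order_refl] by (intro finprod_one_eqI) simp
  qed
  then have "?A \<in> carrier (zero_sum_monoid G)" using zero_sum_image_iff[OF finX \<phi>] by simp
  ultimately show ?thesis unfolding length_sets_system_def by blast
qed

end

section \<open>Finiteness up to isomorphism for groups of bounded order\<close>

lemma finite_non_isomorphic_groups:
  fixes \<G> :: "'a monoid set"
  assumes grp: "\<And>G. G \<in> \<G> \<Longrightarrow> group G \<and> finite (carrier G) \<and> card (carrier G) \<le> b"
    and pw: "pairwise (\<lambda>G H. \<not> G \<cong> H) \<G>"
  shows "finite \<G>"
proof -
  have "\<exists>h. bij_betw h (carrier G) {..<card (carrier G)}" if "G \<in> \<G>" for G
    using grp[OF that] ex_bij_betw_finite_nat[of "carrier G"] by (auto simp: atLeast0LessThan)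
  then obtain h where h: "\<And>G. G \<in> \<G> \<Longrightarrow> bij_betw (h G) (carrier G) {..<card (carrier G)}"
    by metis
  \<comment> \<open>The multiplication table transported to an initial segment of the naturals.
    Restricting its domain puts it in a finite extensional function space; equal tables yield
    isomorphic groups.\<close>
  define t where "t G = (card (carrier G), \<lambda>(i, j) \<in> {..<card (carrier G)} \<times> {..<card (carrier G)}.
    h G (inv_into (carrier G) (h G) i \<otimes>\<^bsub>G\<^esub> inv_into (carrier G) (h G) j))" for G
  have iso: "G \<cong> H" if G: "G \<in> \<G>" and H: "H \<in> \<G>" and eq: "t G = t H" for G H
  proof -
    interpret G: group G using grp G by blast
    interpret H: group H using grp H by blast
    let ?n = "card (carrier G)" and ?f = "inv_into (carrier H) (h H) \<circ> h G"
    have n: "card (carrier H) = ?n" using eq by (simp add: t_def)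
    note bG = h[OF G] and bH = h[OF H, unfolded n]
    have bij: "bij_betw ?f (carrier G) (carrier H)"
      using bij_betw_trans[OF bG bij_betw_inv_into[OF bH]] .
    have "?f (x \<otimes>\<^bsub>G\<^esub> y) = ?f x \<otimes>\<^bsub>H\<^esub> ?f y" if x: "x \<in> carrier G" and y: "y \<in> carrier G" for x y
    proof -
      have lt: "h G x < ?n" "h G y < ?n" using x y bij_betwE[OF bG] by auto
      have "snd (t G) (h G x, h G y) = snd (t H) (h G x, h G y)" using eq by simp
      then have "h G (x \<otimes>\<^bsub>G\<^esub> y) = h H (?f x \<otimes>\<^bsub>H\<^esub> ?f y)"
        using lt x y by (simp add: t_def n bij_betw_inv_into_left[OF bG])
      moreover have "?f x \<in> carrier H" "?f y \<in> carrier H" using bij_betwE[OF bij] x y by auto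
      ultimately show ?thesis by (simp add: bij_betw_inv_into_left[OF bH])
    qed
    then have "?f \<in> iso G H" using bij bij_betwE[OF bij] by (auto simp: iso_def hom_def)
    then show ?thesis by (rule is_isoI)
  qed
  have "inj_on t \<G>" using iso pw unfolding pairwise_def by (intro inj_onI) blast
  moreover have "t ` \<G> \<subseteq> (SIGMA n:{..b}. ({..<n} \<times> {..<n}) \<rightarrow>\<^sub>E {..<n})"
  proof (rule image_subsetI)
    fix G assume G: "G \<in> \<G>"
    interpret group G using grp G by blast
    have "inv_into (carrier G) (h G) i \<in> carrier G" if "i < card (carrier G)" for i
      using bij_betwE[OF bij_betw_inv_into[OF h[OF G]]] that by blast
    then show "t G \<in> (SIGMA n:{..b}. ({..<n} \<times> {..<n}) \<rightarrow>\<^sub>E {..<n})"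
      using grp[OF G] bij_betwE[OF h[OF G]] by (fastforce simp: t_def)
  qed
  moreover have "finite (SIGMA n:{..b}. ({..<n} \<times> {..<n}) \<rightarrow>\<^sub>E {..<n})"
    by (intro finite_SigmaI finite_PiE) auto
  ultimately show ?thesis by (meson finite_imageD finite_subset)
qed

theorem theorem3p7:
  fixes L :: "nat set"
  assumes "finite L" and "L \<noteq> {}" and "L \<subseteq> {2..}"
  shows "\<forall>\<G> :: 'a monoid set.
           (\<forall>G \<in> \<G>. comm_group G \<and> finite (carrier G) \<and> L \<notin> length_sets_system G) \<and>
           pairwise (\<lambda>G H. \<not> G \<cong> H) \<G>
           \<longrightarrow> finite \<G>"
proof (intro allI impI, elim conjE)
  fix \<G> :: "'a monoid set"
  assume \<G>: "\<forall>G \<in> \<G>. comm_group G \<and> finite (carrier G) \<and> L \<notin> length_sets_system G"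
    and pw: "pairwise (\<lambda>G H. \<not> G \<cong> H) \<G>"
  \<comment> \<open>Subtracting \<open>s\<close> moves the minimum of \<open>L\<close> to 2;
    \<open>s\<close> neutral terms restore it.\<close>
  define s where "s = Min L - 2"
  define I where "I = (\<lambda>l. l - s) ` L"
  have min: "Min L \<in> L" "\<And>l. l \<in> L \<Longrightarrow> Min L \<le> l" using assms by auto
  have s2: "Min L = s + 2" using min(1) assms(3) unfolding s_def by auto
  have I: "finite I" "2 \<in> I" "I \<subseteq> {2..}"
    using assms(1) min s2 unfolding I_def by (force intro!: image_eqI[of _ _ "Min L"])+
  have L: "(\<lambda>l. l + s) ` I = L"
    using min(2) s2 unfolding I_def image_image by (force simp: image_iff)
  define N where "N = (5::nat) ^ card (I \<times> grid I \<times> grid I)"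
  \<comment> \<open>A larger group would realize \<open>I\<close>, hence also its shift
    \<open>L\<close>.\<close>
  have "group G \<and> finite (carrier G) \<and> card (carrier G) \<le> N * N + N" if "G \<in> \<G>" for G
  proof -
    interpret comm_group G using \<G> that by blast
    have "\<not> card (carrier G) > N * N + N"
      using length_sets_system_two[OF _ I N_def] length_sets_system_shift[of I s] L \<G> that by auto
    then show ?thesis using \<G> that group_axioms by auto
  qed
  then show "finite \<G>" using finite_non_isomorphic_groups pw by blast
qed

end
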